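(* Let $T\ge1$, let $X_{t+1/2}\in\mathcal X$ for $t=1,\dots,T$ be a sequence of decisions, and let $(a_t)$ and $(b_t)$ be two non-decreasing sequences of weights with $a_t,b_t\ge1$ such that $a_t/b_t$ is non-increasing. Put $B_t=\sum_{s=1}^tb_s$, $\bar X_{t+1/2}=\frac1{B_t}\sum_{s=1}^tb_sX_{s+1/2}$, and $$\mathrm R_T(x^\ast)=\sum_{t=1}^Ta_t\langle\nabla f(\bar X_{t+1/2}),X_{t+1/2}-x^\ast\rangle .$$ Then $$f(\bar X_{T+1/2})-f(x^\ast)\le\frac{\mathrm R_T(x^\ast)}{a_T\,\frac{B_T}{b_T}} .$$
   Context: $\mathcal X\subset\mathbb R^d$ is a nonempty convex compact set. $f:\mathbb R^d\to\mathbb R\cup\{+\infty\}$ is proper, lower semicontinuous, convex and finite on $\mathcal X$, and $\nabla f(x)$ denotes its gradient at $x\in\mathcal X$ (so $f(y)\ge f(x)+\langle\nabla f(x),y-x\rangle$ for all $x,y\in\mathcal X$). $x^\ast\in\arg\min_{x\in\mathcal X}f(x)$, which is assumed nonempty. *)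

theory Defs
  imports "HOL-Analysis.Analysis"
begin

definition effective_domain :: "('a \<Rightarrow> ereal) \<Rightarrow> 'a set" where
  "effective_domain f = {x. f x < \<infinity>}"

definition proper_ereal :: "('a \<Rightarrow> ereal) \<Rightarrow> bool" where
  "proper_ereal f \<longleftrightarrow> (\<forall>x. f x \<noteq> -\<infinity>) \<and> effective_domain f \<noteq> {}"

definition lsc_ereal :: "('a::topological_space \<Rightarrow> ereal) \<Rightarrow> bool" where
  "lsc_ereal f \<longleftrightarrow> (\<forall>x. f x \<le> Liminf (at x) f)"

(* Only meaningful for functions that avoid -\<infinity>, because -\<infinity> + \<infinity> = \<infinity> in type ereal;
   note also 0 * \<infinity> = 0, so the endpoint cases hold trivially. *)
definition convex_ereal :: "('a::real_vector \<Rightarrow> ereal) \<Rightarrow> bool" where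
  "convex_ereal f \<longleftrightarrow>
    (\<forall>x y. \<forall>u\<ge>0. \<forall>v\<ge>0. u + v = 1 \<longrightarrow>
       f (u *\<^sub>R x + v *\<^sub>R y) \<le> ereal u * f x + ereal v * f y)"

(* The derivative is taken relative to the effective domain: at interior points of the domain
   this is the usual gradient (GDERIV), and it also makes sense at boundary points, where f
   takes the value \<infinity> arbitrarily close by. Since real_of_ereal \<infinity> = 0, an unrestricted
   derivative of real_of_ereal o f would be meaningless there. *)
definition has_gradient :: "('a::real_inner \<Rightarrow> ereal) \<Rightarrow> 'a \<Rightarrow> 'a \<Rightarrow> bool" where
  "has_gradient f g x \<longleftrightarrow>
    \<bar>f x\<bar> \<noteq> \<infinity> \<and>
    ((\<lambda>y. real_of_ereal (f y)) has_derivative (\<lambda>h. h \<bullet> g)) (at x within effective_domain f)"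

definition cumulative_weight :: "(nat \<Rightarrow> real) \<Rightarrow> nat \<Rightarrow> real" where
  "cumulative_weight b t = (\<Sum>s=1..t. b s)"

(* X t stands for the half-step iterate with index t + 1/2. *)
definition weighted_average :: "(nat \<Rightarrow> real) \<Rightarrow> (nat \<Rightarrow> 'a::real_vector) \<Rightarrow> nat \<Rightarrow> 'a" where
  "weighted_average b X t = (1 / cumulative_weight b t) *\<^sub>R (\<Sum>s=1..t. b s *\<^sub>R X s)"

definition weighted_regret ::
  "('a::real_inner \<Rightarrow> 'a) \<Rightarrow> (nat \<Rightarrow> real) \<Rightarrow> (nat \<Rightarrow> real) \<Rightarrow> (nat \<Rightarrow> 'a) \<Rightarrow> nat \<Rightarrow> 'a \<Rightarrow> real" where
  "weighted_regret grad a b X T z =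
    (\<Sum>t=1..T. a t * (grad (weighted_average b X t) \<bullet> (X t - z)))"

end

theory Submission
  imports Defs
begin

text \<open>
  Write \<open>B\<^sub>t\<close> for the cumulative weight, \<open>m\<^sub>t\<close> for the weighted average, and
  \<open>\<delta>\<^sub>t = f m\<^sub>t - f x\<^sup>*\<close> for its suboptimality. The update of the average reads
  \<open>b\<^sub>t (X\<^sub>t - m\<^sub>t) = B\<^sub>t\<^sub>-\<^sub>1 (m\<^sub>t - m\<^sub>t\<^sub>-\<^sub>1)\<close>, so the \<open>t\<close>-th term of the regret, multiplied by
  \<open>b\<^sub>t / a\<^sub>t\<close>, is the gradient at \<open>m\<^sub>t\<close> paired with
  \<open>b\<^sub>t (m\<^sub>t - x\<^sup>*) + B\<^sub>t\<^sub>-\<^sub>1 (m\<^sub>t - m\<^sub>t\<^sub>-\<^sub>1)\<close>. The gradient inequality, used once towards \<open>x\<^sup>*\<close> and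
  once towards \<open>m\<^sub>t\<^sub>-\<^sub>1\<close>, bounds it below by
  \<open>b\<^sub>t \<delta>\<^sub>t + B\<^sub>t\<^sub>-\<^sub>1 (\<delta>\<^sub>t - \<delta>\<^sub>t\<^sub>-\<^sub>1) = B\<^sub>t \<delta>\<^sub>t - B\<^sub>t\<^sub>-\<^sub>1 \<delta>\<^sub>t\<^sub>-\<^sub>1\<close>
  (lemma \<open>anytime_regret_step\<close>).

  The regret therefore dominates \<open>\<Sum>\<^sub>t (a\<^sub>t / b\<^sub>t) (B\<^sub>t \<delta>\<^sub>t - B\<^sub>t\<^sub>-\<^sub>1 \<delta>\<^sub>t\<^sub>-\<^sub>1)\<close>. This sum would telescope if
  the ratio \<open>a\<^sub>t / b\<^sub>t\<close> were constant; since the ratio is non-increasing and \<open>B\<^sub>t \<delta>\<^sub>t \<ge> 0\<close> by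
  minimality of \<open>x\<^sup>*\<close>, it is at least its last term \<open>(a\<^sub>T / b\<^sub>T) B\<^sub>T \<delta>\<^sub>T\<close>
  (lemma \<open>antimono_weighted_telescope\<close>). Dividing by \<open>a\<^sub>T B\<^sub>T / b\<^sub>T\<close> gives the bound.
\<close>

text \<open>
  Along the segment from \<open>x\<close> to \<open>y\<close>, convexity bounds every difference quotient of \<open>F\<close> at \<open>x\<close> by
  \<open>F y - F x\<close>, and these quotients tend to the directional derivative. Since the derivative is
  taken within \<open>S\<close>, the point \<open>x\<close> may lie on the boundary.
\<close>

lemma convex_on_gradient_inequality:
  fixes F :: "'a::real_inner \<Rightarrow> real"
  assumes "convex_on S F"
    and deriv: "(F has_derivative (\<lambda>h. h \<bullet> g)) (at x within S)"
    and "x \<in> S" "y \<in> S"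
  shows "F x + g \<bullet> (y - x) \<le> F y"
proof -
  define p where "p u = x + u *\<^sub>R (y - x)" for u :: real
  have p_eq: "p u = (1 - u) *\<^sub>R x + u *\<^sub>R y" for u
    by (simp add: p_def algebra_simps)
  have "convex S"
    using assms(1) by (rule convex_on_imp_convex)
  then have p_in: "p ` {0..1} \<subseteq> S"
    using assms(3,4) by (force simp: p_eq intro: convexD)
  have p_deriv: "(p has_derivative (\<lambda>h. h *\<^sub>R (y - x))) (at 0 within {0..1})"
    unfolding p_def by (auto intro!: derivative_eq_intros)
  have "((F \<circ> p) has_derivative ((\<lambda>h. h \<bullet> g) \<circ> (\<lambda>h. h *\<^sub>R (y - x)))) (at 0 within {0..1})"
    using p_deriv
  proof (rule diff_chain_within)
    show "(F has_derivative (\<lambda>h. h \<bullet> g)) (at (p 0) within p ` {0..1})"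
      using has_derivative_subset[OF deriv p_in] by (simp add: p_def)
  qed
  then have "((F \<circ> p) has_real_derivative (g \<bullet> (y - x))) (at 0 within {0..1})"
    by (simp add: has_field_derivative_def o_def inner_commute mult_commute_abs)
  then have lim: "((\<lambda>u. (F (p u) - F x) / u) \<longlongrightarrow> g \<bullet> (y - x)) (at 0 within {0..1})"
    by (simp add: has_field_derivative_iff p_def)
  have quotient: "(F (p u) - F x) / u \<le> F y - F x" if "u \<in> {0..1}" "u \<noteq> 0" for u
  proof -
    have "F (p u) \<le> (1 - u) * F x + u * F y"
      unfolding p_eq using assms that by (intro convex_onD) auto
    then show ?thesis
      using that by (simp add: field_simps)
  qed
  have "at (0::real) within {0..1} \<noteq> bot"
    by (simp add: trivial_limit_within islimpt_Icc)
  then have "g \<bullet> (y - x) \<le> F y - F x"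
    by (intro tendsto_upperbound[OF lim])
      (auto simp: eventually_at_filter intro!: always_eventually quotient)
  then show ?thesis
    by simp
qed

text \<open>
  A convex function on a set where it is finite is an ordinary real convex function there, so the
  preceding inequality applies once the derivative is restricted from the effective domain.
\<close>

lemma gradient_inequality_ereal:
  fixes f :: "'a::real_inner \<Rightarrow> ereal"
  assumes "convex S" "convex_ereal f"
    and finite: "\<And>x. x \<in> S \<Longrightarrow> \<bar>f x\<bar> \<noteq> \<infinity>"
    and "has_gradient f g x" "x \<in> S" "y \<in> S"
  shows "real_of_ereal (f x) + g \<bullet> (y - x) \<le> real_of_ereal (f y)"
proof (rule convex_on_gradient_inequality[of S])
  have real: "ereal (real_of_ereal (f v)) = f v" if "v \<in> S" for v
    using finite[OF that] by (simp add: ereal_real)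
  show "convex_on S (\<lambda>x. real_of_ereal (f x))"
  proof (rule convex_onI)
    fix t :: real and x y
    assume t: "0 < t" "t < 1" and xy: "x \<in> S" "y \<in> S"
    then have "(1 - t) *\<^sub>R x + t *\<^sub>R y \<in> S"
      using \<open>convex S\<close> by (intro convexD) auto
    moreover have "f ((1 - t) *\<^sub>R x + t *\<^sub>R y) \<le> ereal (1 - t) * f x + ereal t * f y"
      using \<open>convex_ereal f\<close> t unfolding convex_ereal_def by simp
    ultimately have "ereal (real_of_ereal (f ((1 - t) *\<^sub>R x + t *\<^sub>R y)))
        \<le> ereal (1 - t) * ereal (real_of_ereal (f x)) + ereal t * ereal (real_of_ereal (f y))"
      using xy by (simp only: real)
    then show "real_of_ereal (f ((1 - t) *\<^sub>R x + t *\<^sub>R y))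
        \<le> (1 - t) * real_of_ereal (f x) + t * real_of_ereal (f y)"
      by simp
  qed (fact \<open>convex S\<close>)
  have "S \<subseteq> effective_domain f"
    using finite by (force simp: effective_domain_def)
  then show "((\<lambda>y. real_of_ereal (f y)) has_derivative (\<lambda>h. h \<bullet> g)) (at x within S)"
    using \<open>has_gradient f g x\<close> has_derivative_subset unfolding has_gradient_def by blast
qed fact+

lemma cumulative_weight_0 [simp]: "cumulative_weight b 0 = 0"
  by (simp add: cumulative_weight_def)

lemma cumulative_weight_Suc:
  "cumulative_weight b (Suc n) = cumulative_weight b n + b (Suc n)"
  by (simp add: cumulative_weight_def)

lemma cumulative_weight_nonneg:
  assumes "\<And>s. s \<in> {1..t} \<Longrightarrow> b s \<ge> 0"
  shows "cumulative_weight b t \<ge> 0"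
  unfolding cumulative_weight_def using assms by (rule sum_nonneg)

lemma cumulative_weight_pos:
  assumes "t \<ge> 1" "\<And>s. s \<in> {1..t} \<Longrightarrow> b s > 0"
  shows "cumulative_weight b t > 0"
  unfolding cumulative_weight_def using assms by (intro sum_pos) auto

lemma weighted_average_mem_convex:
  assumes "convex S" "t \<ge> 1"
    and "\<And>s. s \<in> {1..t} \<Longrightarrow> b s > 0" "\<And>s. s \<in> {1..t} \<Longrightarrow> X s \<in> S"
  shows "weighted_average b X t \<in> S"
proof -
  have pos: "cumulative_weight b t > 0"
    using assms by (intro cumulative_weight_pos)
  have "(\<Sum>s=1..t. (b s / cumulative_weight b t) *\<^sub>R X s) \<in> S"
    using assms pos
    by (intro convex_sum) (auto simp: less_imp_le cumulative_weight_def simp flip: sum_divide_distrib)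
  then show ?thesis
    by (simp add: weighted_average_def scaleR_sum_right)
qed

text \<open>
  For \<open>n = 0\<close> the average of the empty family is the default value \<open>0\<close>, which is harmless because
  it is multiplied by \<open>cumulative_weight b 0 = 0\<close>.
\<close>

lemma weighted_average_update:
  assumes "\<And>s. s \<in> {1..Suc n} \<Longrightarrow> b s > 0"
  shows "b (Suc n) *\<^sub>R (X (Suc n) - weighted_average b X (Suc n))
    = cumulative_weight b n *\<^sub>R (weighted_average b X (Suc n) - weighted_average b X n)"
proof -
  have scaled: "cumulative_weight b t *\<^sub>R weighted_average b X t = (\<Sum>s=1..t. b s *\<^sub>R X s)"
    if "t \<le> Suc n" for t
  proof (cases "t = 0")
    case False
    then have "cumulative_weight b t > 0"
      using that assms by (intro cumulative_weight_pos) auto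
    then show ?thesis
      by (simp add: weighted_average_def)
  qed (simp add: weighted_average_def)
  have "(cumulative_weight b n + b (Suc n)) *\<^sub>R weighted_average b X (Suc n)
      = cumulative_weight b n *\<^sub>R weighted_average b X n + b (Suc n) *\<^sub>R X (Suc n)"
    using scaled[of "Suc n"] scaled[of n] by (simp add: cumulative_weight_Suc)
  then show ?thesis
    by (simp add: algebra_simps)
qed

text \<open>
  By the update rule the left-hand side splits into a step from \<open>z\<close> to the new average and a
  multiple of the step from the old average to the new one; \<open>to_z\<close> and \<open>to_old\<close> control one
  part each. The inequality towards the old average can only be asked for \<open>n \<ge> 1\<close>, as otherwise
  there is no old average.
\<close>

lemma anytime_regret_step:
  fixes F :: "'a::real_inner \<Rightarrow> real"
  assumes b: "\<And>s. s \<in> {1..Suc n} \<Longrightarrow> b s > 0"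
    and to_z: "F (weighted_average b X (Suc n)) + g \<bullet> (z - weighted_average b X (Suc n)) \<le> F z"
    and to_old: "n \<ge> 1 \<Longrightarrow>
      F (weighted_average b X (Suc n))
        + g \<bullet> (weighted_average b X n - weighted_average b X (Suc n))
      \<le> F (weighted_average b X n)"
  shows "cumulative_weight b (Suc n) * (F (weighted_average b X (Suc n)) - F z)
      - cumulative_weight b n * (F (weighted_average b X n) - F z)
    \<le> b (Suc n) * (g \<bullet> (X (Suc n) - z))"
proof -
  let ?B = "cumulative_weight b n" and ?m = "weighted_average b X n"
  let ?m' = "weighted_average b X (Suc n)"
  have "b (Suc n) * (F ?m' - F z) \<le> b (Suc n) * (g \<bullet> (?m' - z))"
    using to_z b[of "Suc n"] by (intro mult_left_mono) (auto simp: inner_diff_right)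
  moreover have "?B * (F ?m' - F ?m) \<le> ?B * (g \<bullet> (?m' - ?m))"
  proof (cases "n = 0")
    case False
    have "?B \<ge> 0"
      using b by (intro cumulative_weight_nonneg) (auto simp: less_imp_le)
    then show ?thesis
      using to_old False by (intro mult_left_mono) (auto simp: inner_diff_right)
  qed simp
  moreover have "b (Suc n) * (g \<bullet> (X (Suc n) - ?m')) = ?B * (g \<bullet> (?m' - ?m))"
    using arg_cong[OF weighted_average_update[where X = X, OF b], where f = "\<lambda>v. g \<bullet> v"] by simp
  ultimately show ?thesis
    by (simp add: cumulative_weight_Suc inner_diff_right algebra_simps)
qed

text \<open>
  Replacing the weight \<open>r (Suc n)\<close> of \<open>C n\<close> by the larger \<open>r n\<close> lowers the sum, because \<open>C n \<ge> 0\<close>,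
  and makes it telescope.
\<close>

lemma antimono_weighted_telescope:
  fixes r C :: "nat \<Rightarrow> real"
  assumes "N \<ge> 1" "antimono_on {1..N} r" "\<And>n. n \<in> {1..N} \<Longrightarrow> C n \<ge> 0" "C 0 = 0"
  shows "r N * C N \<le> (\<Sum>n=1..N. r n * (C n - C (n - 1)))"
  using assms
proof (induction N rule: nat_induct_at_least)
  case (Suc n)
  have "r n * C n \<le> (\<Sum>k=1..n. r k * (C k - C (k - 1)))"
    using Suc.prems by (intro Suc.IH) (auto intro: monotone_on_subset)
  moreover have "r (Suc n) * C n \<le> r n * C n"
    using Suc.hyps Suc.prems by (intro mult_right_mono) (auto elim!: monotone_onD)
  ultimately show ?case
    by (simp add: algebra_simps)
qed simp

theorem theorem3p3:
  fixes \<X> :: "(real ^ 'd) set"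
    and f :: "real ^ 'd \<Rightarrow> ereal"
    and grad :: "real ^ 'd \<Rightarrow> real ^ 'd"
    and xstar :: "real ^ 'd"
    and X :: "nat \<Rightarrow> real ^ 'd"
    and a b :: "nat \<Rightarrow> real"
    and T :: nat
  assumes "\<X> \<noteq> {}" and "convex \<X>" and "compact \<X>"
    and "proper_ereal f" and "lsc_ereal f" and "convex_ereal f"
    and "\<And>x. x \<in> \<X> \<Longrightarrow> \<bar>f x\<bar> \<noteq> \<infinity>"
    and "\<And>x. x \<in> \<X> \<Longrightarrow> has_gradient f (grad x) x"
    and "is_arg_min f (\<lambda>x. x \<in> \<X>) xstar"
    and "T \<ge> 1"
    and "\<And>t. t \<in> {1..T} \<Longrightarrow> X t \<in> \<X>"
    and "mono_on {1..T} a" and "mono_on {1..T} b"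
    and "\<And>t. t \<in> {1..T} \<Longrightarrow> a t \<ge> 1" and "\<And>t. t \<in> {1..T} \<Longrightarrow> b t \<ge> 1"
    and "antimono_on {1..T} (\<lambda>t. a t / b t)"
  shows "f (weighted_average b X T) - f xstar
    \<le> ereal (weighted_regret grad a b X T xstar / (a T * (cumulative_weight b T / b T)))"
proof -
  let ?B = "cumulative_weight b" and ?m = "weighted_average b X"
  define F where "F x = real_of_ereal (f x)" for x
  have f_eq: "f x = ereal (F x)" if "x \<in> \<X>" for x
    using assms(7)[OF that] by (simp add: F_def ereal_real)
  have z: "xstar \<in> \<X>" and "\<And>x. x \<in> \<X> \<Longrightarrow> \<not> f x < f xstar"
    using assms(9) by (auto simp: is_arg_min_def)
  then have F_min: "F xstar \<le> F x" if "x \<in> \<X>" for x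
    using that by (simp add: f_eq not_less)
  have a_pos: "a t > 0" and b_pos: "b t > 0" if "t \<in> {1..T}" for t
    using assms(14)[OF that] assms(15)[OF that] by auto
  have m_in: "?m t \<in> \<X>" if "t \<in> {1..T}" for t
    using that assms(2,11) b_pos by (intro weighted_average_mem_convex) auto
  have subgrad: "F x + grad x \<bullet> (y - x) \<le> F y" if "x \<in> \<X>" "y \<in> \<X>" for x y
    unfolding F_def using assms(2,6,7,8) that by (intro gradient_inequality_ereal[of \<X>])

  define C where "C t = ?B t * (F (?m t) - F xstar)" for t
  have C_nonneg: "C t \<ge> 0" if "t \<in> {1..T}" for t
    unfolding C_def using that F_min[OF m_in[OF that]] b_pos
    by (intro mult_nonneg_nonneg cumulative_weight_nonneg) (auto simp: less_imp_le)
  have step: "a t / b t * (C t - C (t - 1)) \<le> a t * (grad (?m t) \<bullet> (X t - xstar))"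
    if t: "t \<in> {1..T}" for t
  proof -
    obtain n where n: "t = Suc n"
      using t by (cases t) auto
    have "C t - C n \<le> b t * (grad (?m t) \<bullet> (X t - xstar))"
      unfolding C_def n using t n b_pos m_in z
      by (intro anytime_regret_step subgrad) auto
    then have "a t / b t * (C t - C n) \<le> a t / b t * (b t * (grad (?m t) \<bullet> (X t - xstar)))"
      using a_pos[OF t] b_pos[OF t] by (intro mult_left_mono) auto
    then show ?thesis
      using b_pos[OF t] n by simp
  qed
  have "a T / b T * C T \<le> (\<Sum>t=1..T. a t / b t * (C t - C (t - 1)))"
    using assms(10,16) C_nonneg
    by (intro antimono_weighted_telescope[where r = "\<lambda>t. a t / b t"]) (auto simp: C_def)
  also have "\<dots> \<le> weighted_regret grad a b X T xstar"
    unfolding weighted_regret_def using step by (intro sum_mono)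
  finally have regret: "a T / b T * C T \<le> weighted_regret grad a b X T xstar" .

  have T: "T \<in> {1..T}"
    using assms(10) by simp
  have "?B T > 0"
    using assms(10) b_pos by (intro cumulative_weight_pos)
  then have "F (?m T) - F xstar
      \<le> weighted_regret grad a b X T xstar / (a T * (?B T / b T))"
    using regret a_pos[OF T] b_pos[OF T] by (simp add: C_def field_simps)
  then show ?thesis
    by (simp add: f_eq m_in[OF T] z)
qed

end
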